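(* For integers $n, m \geq 0$, let $cp_{1-2}(n, m)$ denote the number of partitions of $n$ into $m$ parts $\lambda_1 \leq \cdots \leq \lambda_m$ such that $\lambda_{i+1} - \lambda_i \geq 2$ for all $i$, and $\lambda_{i+1} - \lambda_i \geq 4$ unless $\lambda_i + \lambda_{i+1} \equiv 2 \pmod{3}$. Then \[ \sum_{m, n \geq 0} cp_{1-2}(n,m) q^n x^m = \sum_{n_1, n_2 \geq 0} \frac{ q^{6n_2^2 - n_2 + 2n_1^2 - n_1 + 6n_2 n_1} x^{2n_2 + n_1} }{ (q; q)_{n_1} (q^3; q^3)_{n_2} }. \]
   Context: A partition of $n$ into $m$ parts is a non-decreasing sequence of $m$ positive integers summing to $n$. For $n \geq 0$, $(a; q)_n = \prod_{j=1}^{n} (1 - a q^{j-1})$, with the empty product equal to $1$. *)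

theory Defs
  imports
    "HOL-Analysis.Infinite_Sum"
    "HOL-Computational_Algebra.Formal_Power_Series"
    "HOL-Number_Theory.Cong"
begin

definition qpochhammer :: "'a::comm_ring_1 \<Rightarrow> 'a \<Rightarrow> nat \<Rightarrow> 'a" where
  "qpochhammer a q n = (\<Prod>j=1..n. 1 - a * q ^ (j - 1))"

definition partition_into :: "nat \<Rightarrow> nat \<Rightarrow> nat list \<Rightarrow> bool" where
  "partition_into n m l \<longleftrightarrow>
     length l = m \<and> sorted l \<and> (\<forall>a\<in>set l. 0 < a) \<and> sum_list l = n"

text \<open>The subtractions never truncate for a sorted list. Indices start at 0, so \<open>l ! i\<close>
  is \<open>\<lambda>\<^bsub>i+1\<^esub>\<close>.\<close>

definition cp12_condition :: "nat list \<Rightarrow> bool" where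
  "cp12_condition l \<longleftrightarrow>
     (\<forall>i. Suc i < length l \<longrightarrow>
        l ! Suc i - l ! i \<ge> 2 \<and>
        (\<not> [l ! i + l ! Suc i = 2] (mod 3) \<longrightarrow> l ! Suc i - l ! i \<ge> 4))"

definition cp12 :: "nat \<Rightarrow> nat \<Rightarrow> nat" where
  "cp12 n m = card {l. partition_into n m l \<and> cp12_condition l}"

text \<open>Bivariate series live in \<open>\<rat>[[q]][[x]]\<close>, the type \<^typ>\<open>rat fps fps\<close>: the inner variable is
  \<open>q\<close> and the outer one is \<open>x\<close>. The library topology on this type is the \<open>x\<close>-adic one.\<close>

abbreviation q_var :: "rat fps" where
  "q_var \<equiv> fps_X"

abbreviation x_var :: "rat fps fps" where
  "x_var \<equiv> fps_X"

end

theory Submission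
  imports Defs
begin

text \<open>
  Let \<open>S(i,j)\<close> be the double series with the extra factor \<open>q^(i n\<^sub>1 + j n\<^sub>2)\<close> in the summand.
  Cancelling the last factor of one of the two \<open>q\<close>-Pochhammer symbols gives
  \<open>S(i,j) = S(i+1,j) + x q^(i+1) S(i+4,j+6)\<close> and
  \<open>S(i,j) = S(i,j+3) + x\<^sup>2 q^(j+5) S(i+6,j+12)\<close>.
  On the other side, let \<open>G(k)\<close> be the generating function of the admissible partitions with all
  parts greater than \<open>k\<close>. Removing the part \<open>k+1\<close>, if present, expresses \<open>G(k) - G(k+1)\<close> as
  \<open>x q^(k+1) G(k+3)\<close>, \<open>x q^(k+1) G(k+4)\<close> or \<open>x q^(k+1) G(k+4) + x\<^sup>2 q^(2k+4) G(k+6)\<close> for \<open>k\<close>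
  congruent to 0, 1 or 2 modulo 3. As \<open>G(k)\<close> tends to 1, these recurrences determine \<open>G\<close>, and the
  two relations above show that \<open>S(k,j)\<close> solves them when \<open>j\<close> is the multiple of 3 nearest to
  \<open>2k\<close>. The theorem is the case \<open>k = 0\<close>.
\<close>

unbundle fps_syntax

subsection \<open>Sums over the fibres of a weight\<close>

definition weighted_gf :: "('i \<Rightarrow> nat) \<Rightarrow> ('i \<Rightarrow> 'a::comm_monoid_add) \<Rightarrow> 'a fps" where
  "weighted_gf w f = Abs_fps (\<lambda>m. \<Sum>p | w p = m. f p)"

lemma weighted_gf_add:
  "weighted_gf w (\<lambda>p. f p + g p) = weighted_gf w f + weighted_gf w g"
  by (simp add: weighted_gf_def fps_eq_iff sum.distrib)

lemma weighted_gf_cmult: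
  fixes f :: "'i \<Rightarrow> 'a::comm_semiring_1"
  shows "weighted_gf w (\<lambda>p. c * f p) = fps_const c * weighted_gf w f"
  by (simp add: weighted_gf_def fps_eq_iff sum_distrib_left)

lemma weighted_gf_reindex:
  fixes f :: "'i \<Rightarrow> 'a::comm_semiring_1"
  assumes finite: "\<And>m. finite {p. w p = m}"
    and inj: "inj h"
    and weight: "\<And>p. w (h p) = v p + r"
    and zero: "\<And>p. p \<notin> range h \<Longrightarrow> f p = 0"
  shows "weighted_gf w f = fps_X ^ r * weighted_gf v (\<lambda>p. f (h p))"
proof (rule fps_ext)
  fix m
  have "(\<Sum>p | w p = m. f p) = (\<Sum>p\<in>h ` {p. v p + r = m}. f p)"
    by (rule sum.mono_neutral_right[OF finite]) (auto simp: weight intro!: zero)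
  also have "\<dots> = (\<Sum>p | v p + r = m. f (h p))"
    by (simp add: sum.reindex[OF inj_on_subset[OF inj]])
  also have "\<dots> = (if m < r then 0 else \<Sum>p | v p = m - r. f (h p))"
    by (auto intro!: sum.cong sum.neutral)
  finally show "weighted_gf w f $ m = (fps_X ^ r * weighted_gf v (\<lambda>p. f (h p))) $ m"
    by (simp add: weighted_gf_def fps_X_power_mult_nth)
qed

lemma weighted_gf_split_range:
  fixes f g :: "'i \<Rightarrow> 'a::comm_ring_1"
  assumes finite: "\<And>m. finite {p. w p = m}"
    and inj: "inj h"
    and weight: "\<And>p. w (h p) = v p + r"
    and on_range: "\<And>p. f (h p) = g (h p) + c * e p"
    and off_range: "\<And>p. p \<notin> range h \<Longrightarrow> f p = g p"
  shows "weighted_gf w f = weighted_gf w g + fps_X ^ r * (fps_const c * weighted_gf v e)"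
proof -
  have "weighted_gf w f = weighted_gf w g + weighted_gf w (\<lambda>p. f p - g p)"
    by (simp flip: weighted_gf_add)
  also have "weighted_gf w (\<lambda>p. f p - g p) = fps_X ^ r * weighted_gf v (\<lambda>p. c * e p)"
    by (subst weighted_gf_reindex[OF finite inj weight]) (simp_all add: on_range off_range)
  finally show ?thesis
    by (simp only: weighted_gf_cmult)
qed

lemma has_sum_weighted_gf:
  fixes f :: "'i \<Rightarrow> 'a::comm_ring_1"
  assumes finite: "\<And>m. finite {p. w p = m}"
  shows "((\<lambda>p. fps_const (f p) * fps_X ^ w p) has_sum weighted_gf w f) UNIV"
proof -
  let ?t = "\<lambda>p. fps_const (f p) * fps_X ^ w p"
  have "\<forall>\<^sub>F F in finite_subsets_at_top UNIV. (\<Sum>p\<in>F. ?t p) $ m = weighted_gf w f $ m" for m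
    unfolding eventually_finite_subsets_at_top
  proof (intro exI[of _ "{p. w p = m}"] conjI allI impI)
    fix F assume "finite F \<and> {p. w p = m} \<subseteq> F \<and> F \<subseteq> UNIV"
    moreover have "?t p $ m = (if w p = m then f p else 0)" for p
      by (auto simp: fps_X_power_mult_right_nth)
    ultimately show "(\<Sum>p\<in>F. ?t p) $ m = weighted_gf w f $ m"
      by (simp add: fps_sum_nth weighted_gf_def sum.If_cases Int_absorb1)
  qed (simp_all add: finite)
  then show ?thesis
    unfolding has_sum_def by (rule tendsto_fpsI)
qed

subsection \<open>The double series\<close>

definition qexp :: "nat \<Rightarrow> nat \<Rightarrow> nat" where
  "qexp a b = 6 * b\<^sup>2 - b + 2 * a\<^sup>2 - a + 6 * b * a"

lemma of_nat_qexp: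
  "int (qexp a b) = 6 * int b ^ 2 - int b + 2 * int a ^ 2 - int a + 6 * int b * int a"
proof -
  have "a \<le> 2 * a\<^sup>2" "b \<le> 6 * b\<^sup>2"
    using le_square[of a] le_square[of b] by (simp_all add: power2_eq_square)
  then show ?thesis
    by (simp add: qexp_def of_nat_diff)
qed

lemma qexp_0_0: "qexp 0 0 = 0"
  by (simp add: qexp_def)

lemma qexp_Suc_left: "qexp (Suc a) b = qexp a b + 4 * a + 6 * b + 1"
proof -
  have "int (qexp (Suc a) b) = int (qexp a b + 4 * a + 6 * b + 1)"
    by (simp add: of_nat_qexp power2_eq_square algebra_simps)
  then show ?thesis
    by (simp only: of_nat_eq_iff)
qed

lemma qexp_Suc_right: "qexp a (Suc b) = qexp a b + 12 * b + 6 * a + 5"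
proof -
  have "int (qexp a (Suc b)) = int (qexp a b + 12 * b + 6 * a + 5)"
    by (simp add: of_nat_qexp power2_eq_square algebra_simps)
  then show ?thesis
    by (simp only: of_nat_eq_iff)
qed

lemma qexp_ge: "a + 5 * b \<le> qexp a b"
proof (induction a)
  case 0
  show ?case
    by (induction b) (simp_all add: qexp_Suc_right)
qed (simp add: qexp_Suc_left)

lemma qpochhammer_Suc: "qpochhammer a q (Suc n) = qpochhammer a q n * (1 - a * q ^ n)"
  by (simp add: qpochhammer_def)

lemma qpochhammer_fps_nth_0:
  fixes a q :: "'a::comm_ring_1 fps"
  assumes "a $ 0 = 0"
  shows "qpochhammer a q n $ 0 = 1"
  by (induction n) (simp_all add: qpochhammer_Suc assms, simp add: qpochhammer_def)

lemma inverse_qpochhammer_Suc: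
  fixes a q :: "'a::field fps"
  assumes "a $ 0 = 0"
  shows "(1 - a * q ^ n) * inverse (qpochhammer a q (Suc n)) = inverse (qpochhammer a q n)"
proof -
  have "(1 - a * q ^ n) * inverse (1 - a * q ^ n) = 1"
    by (rule inverse_mult_eq_1') (simp add: assms)
  then show ?thesis
    by (simp add: qpochhammer_Suc fps_inverse_mult mult_ac)
qed

definition qterm :: "nat \<Rightarrow> nat \<Rightarrow> nat \<Rightarrow> nat \<Rightarrow> 'a::field fps" where
  "qterm i j a b = fps_X ^ (qexp a b + i * a + j * b) *
     inverse (qpochhammer fps_X fps_X a) * inverse (qpochhammer (fps_X ^ 3) (fps_X ^ 3) b)"

lemma qterm_0_left: "qterm i j 0 b = qterm i' j 0 b"
  by (simp add: qterm_def)

lemma qterm_0_right: "qterm i j a 0 = qterm i j' a 0"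
  by (simp add: qterm_def)

lemma qterm_Suc_left:
  "qterm i j (Suc a) b =
     qterm (i + 1) j (Suc a) b + fps_X ^ (i + 1) * qterm (i + 4) (j + 6) a b"
proof -
  let ?e = "qexp (Suc a) b + i * Suc a + j * b"
  let ?u = "inverse (qpochhammer fps_X fps_X (Suc a)) :: 'a fps"
  let ?v = "inverse (qpochhammer (fps_X ^ 3) (fps_X ^ 3) b) :: 'a fps"
  have "qterm i j (Suc a) b - qterm (i + 1) j (Suc a) b
      = fps_X ^ ?e * ((1 - fps_X * fps_X ^ a) * ?u) * ?v"
    by (simp add: qterm_def algebra_simps power_add)
  also have "\<dots> = fps_X ^ ?e * inverse (qpochhammer fps_X fps_X a) * ?v"
    by (subst inverse_qpochhammer_Suc) simp_all
  also have "\<dots> = fps_X ^ (i + 1) * qterm (i + 4) (j + 6) a b"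
    by (simp add: qterm_def qexp_Suc_left algebra_simps flip: power_add)
  finally show ?thesis
    by (simp add: algebra_simps)
qed

lemma qterm_Suc_right:
  "qterm i j a (Suc b) =
     qterm i (j + 3) a (Suc b) + fps_X ^ (j + 5) * qterm (i + 6) (j + 12) a b"
proof -
  let ?e = "qexp a (Suc b) + i * a + j * Suc b"
  let ?u = "inverse (qpochhammer fps_X fps_X a) :: 'a fps"
  let ?v = "inverse (qpochhammer (fps_X ^ 3) (fps_X ^ 3) (Suc b)) :: 'a fps"
  have "qterm i j a (Suc b) - qterm i (j + 3) a (Suc b)
      = fps_X ^ ?e * ?u * ((1 - fps_X ^ 3 * (fps_X ^ 3) ^ b) * ?v)"
    by (simp add: qterm_def algebra_simps flip: power_add power_mult)
  also have "\<dots> = fps_X ^ ?e * ?u * inverse (qpochhammer (fps_X ^ 3) (fps_X ^ 3) b)"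
    by (subst inverse_qpochhammer_Suc) simp_all
  also have "\<dots> = fps_X ^ (j + 5) * qterm (i + 6) (j + 12) a b"
    by (simp add: qterm_def qexp_Suc_right algebra_simps flip: power_add)
  finally show ?thesis
    by (simp add: algebra_simps)
qed

lemma qterm_nth_low:
  assumes "n \<le> i" "n < j + 5"
  shows "qterm i j a b $ n = (if a = 0 \<and> b = 0 then 1 $ n else 0)"
proof (cases "a = 0 \<and> b = 0")
  case True
  then show ?thesis
    by (simp add: qterm_def qexp_0_0 qpochhammer_def)
next
  case False
  then have "n < qexp a b + i * a + j * b"
    using qexp_ge[of a b] assms by (cases a; cases b) auto
  then show ?thesis
    using False by (auto simp: qterm_def mult.assoc fps_X_power_mult_nth)
qed

definition pair_weight :: "nat \<times> nat \<Rightarrow> nat" where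
  "pair_weight p = fst p + 2 * snd p"

lemma finite_pair_weight: "finite {p. pair_weight p = m}"
  by (rule finite_subset[of _ "{..m} \<times> {..m}"]) (auto simp: pair_weight_def)

definition double_series :: "nat \<Rightarrow> nat \<Rightarrow> 'a::field fps fps" where
  "double_series i j = weighted_gf pair_weight (\<lambda>(a, b). qterm i j a b)"

abbreviation q_power :: "nat \<Rightarrow> 'a::comm_semiring_1 fps fps" where
  "q_power n \<equiv> fps_const (fps_X ^ n)"

lemma q_power_eq_mult: "l = m + n \<Longrightarrow> q_power l = q_power m * q_power n"
  by (simp add: power_add)

lemma double_series_shift_left:
  "double_series i j =
     double_series (i + 1) j + fps_X * (q_power (i + 1) * double_series (i + 4) (j + 6))"
proof -
  have "a = 0" if "(a, b) \<notin> range (map_prod Suc id)" for a b :: nat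
    using that by (cases a) (auto simp: image_iff)
  then have "double_series i j = double_series (i + 1) j
      + fps_X ^ 1 * (q_power (i + 1) * double_series (i + 4) (j + 6))"
    unfolding double_series_def
    by (intro weighted_gf_split_range[where h = "map_prod Suc id"] finite_pair_weight prod.inj_map)
      (auto simp: pair_weight_def qterm_Suc_left[of i j] intro: qterm_0_left)
  then show ?thesis
    by (simp only: power_one_right)
qed

lemma double_series_shift_right:
  "double_series i j =
     double_series i (j + 3) + fps_X\<^sup>2 * (q_power (j + 5) * double_series (i + 6) (j + 12))"
proof -
  have "b = 0" if "(a, b) \<notin> range (map_prod id Suc)" for a b :: nat
    using that by (cases b) (auto simp: image_iff)
  then show ?thesis
    unfolding double_series_def
    by (intro weighted_gf_split_range[where h = "map_prod id Suc"] finite_pair_weight prod.inj_map)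
      (auto simp: pair_weight_def qterm_Suc_right[of i j] intro: qterm_0_right)
qed

lemma double_series_shift_both:
  "double_series i j = double_series (i + 1) (j + 3)
     + fps_X * (q_power (i + 1) * double_series (i + 4) (j + 9))
     + fps_X\<^sup>2 * (q_power (j + 5) * double_series (i + 6) (j + 12))"
  by (subst double_series_shift_right, subst double_series_shift_left) (simp add: add.assoc)

lemma double_series_shift_diagonal:
  "double_series i (2 * i) = double_series (i + 1) (2 * i + 3)
     + fps_X * (q_power (i + 1) * double_series (i + 3) (2 * i + 6))"
proof -
  let ?S = "double_series :: nat \<Rightarrow> nat \<Rightarrow> 'a fps fps"
  have shift_right: "?S (i + 1) (2 * i) = ?S (i + 1) (2 * i + 3)
      + fps_X\<^sup>2 * (q_power (2 * i + 5) * ?S (i + 7) (2 * i + 12))"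
    by (subst double_series_shift_right) (simp add: add.commute)
  have shift_left: "?S (i + 3) (2 * i + 6) = ?S (i + 4) (2 * i + 6)
      + fps_X * (q_power (i + 4) * ?S (i + 7) (2 * i + 12))"
    by (subst double_series_shift_left) (simp add: add.commute)
  have q_split: "q_power (2 * i + 5) = (q_power (i + 1) * q_power (i + 4) :: 'a fps fps)"
    by (rule q_power_eq_mult) simp
  have "?S i (2 * i) = ?S (i + 1) (2 * i) + fps_X * (q_power (i + 1) * ?S (i + 4) (2 * i + 6))"
    by (rule double_series_shift_left)
  also have "\<dots> = ?S (i + 1) (2 * i + 3) + fps_X * (q_power (i + 1) * ?S (i + 3) (2 * i + 6))"
    unfolding shift_right shift_left q_split
    by (simp only: distrib_left mult_ac power2_eq_square add_ac)
  finally show ?thesis .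
qed

lemma double_series_nth_low:
  assumes "n \<le> i" "n < j + 5"
  shows "double_series i j $ m $ n = 1 $ m $ n"
proof -
  have "double_series i j $ m $ n
      = (\<Sum>p | pair_weight p = m. if p = (0, 0) then 1 $ n else 0)"
    unfolding double_series_def weighted_gf_def fps_nth_Abs_fps fps_sum_nth
    by (rule sum.cong) (auto simp: qterm_nth_low[OF assms] split: if_splits)
  also have "\<dots> = 1 $ m $ n"
    by (subst sum.delta[OF finite_pair_weight]) (auto simp: pair_weight_def)
  finally show ?thesis .
qed

subsection \<open>Generating functions of sets of lists\<close>

definition list_gf :: "nat list set \<Rightarrow> 'a::comm_semiring_1 fps fps" where
  "list_gf A = Abs_fps (\<lambda>m. Abs_fps (\<lambda>n. of_nat (card {l \<in> A. length l = m \<and> sum_list l = n})))"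

lemma finite_lists_length_sum: "finite {l \<in> A. length l = m \<and> sum_list l = (n :: nat)}"
proof (rule finite_subset[OF _ finite_lists_length_eq[of "{..n}" m]])
  show "{l \<in> A. length l = m \<and> sum_list l = n} \<subseteq> {l. set l \<subseteq> {..n} \<and> length l = m}"
    by (auto simp: member_le_sum_list)
qed simp

lemma list_gf_Un:
  assumes "A \<inter> B = {}"
  shows "list_gf (A \<union> B) = list_gf A + list_gf B"
proof -
  have "card {l \<in> A \<union> B. length l = m \<and> sum_list l = n}
      = card {l \<in> A. length l = m \<and> sum_list l = n} + card {l \<in> B. length l = m \<and> sum_list l = n}"
    for m n
  proof (subst card_Un_disjoint[symmetric])
    show "{l \<in> A. length l = m \<and> sum_list l = n} \<inter> {l \<in> B. length l = m \<and> sum_list l = n} = {}"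
      using assms by auto
  qed (auto intro: finite_lists_length_sum arg_cong[of _ _ card])
  then show ?thesis
    by (simp add: list_gf_def fps_eq_iff)
qed

lemma list_gf_Cons:
  "list_gf ((#) k ` A) = fps_X * (q_power k * list_gf A)"
proof (intro fps_ext)
  fix m n
  show "list_gf ((#) k ` A) $ m $ n = (fps_X * (q_power k * list_gf A)) $ m $ n"
  proof (cases "m = 0 \<or> n < k")
    case True
    then have "{l \<in> (#) k ` A. length l = m \<and> sum_list l = n} = {}"
      by auto
    with True show ?thesis
      by (auto simp: list_gf_def fps_X_power_mult_nth simp del: Collect_empty_eq)
  next
    case False
    then have "{l \<in> (#) k ` A. length l = m \<and> sum_list l = n}
        = (#) k ` {l \<in> A. length l = m - 1 \<and> sum_list l = n - k}"
      by auto
    then have "card {l \<in> (#) k ` A. length l = m \<and> sum_list l = n}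
        = card {l \<in> A. length l = m - 1 \<and> sum_list l = n - k}"
      by (simp add: card_image)
    with False show ?thesis
      by (simp add: list_gf_def fps_X_power_mult_nth)
  qed
qed

definition lists_hd_above :: "(nat \<Rightarrow> nat \<Rightarrow> bool) \<Rightarrow> nat \<Rightarrow> nat list set" where
  "lists_hd_above R k = {l. successively R l \<and> (l = [] \<or> k < hd l)}"

lemma lists_hd_above_split:
  "lists_hd_above R k = lists_hd_above R (Suc k) \<union> (#) (Suc k) ` {l. successively R (Suc k # l)}"
proof (rule set_eqI)
  fix l
  show "l \<in> lists_hd_above R k
      \<longleftrightarrow> l \<in> lists_hd_above R (Suc k) \<union> (#) (Suc k) ` {l. successively R (Suc k # l)}"
  proof (cases l)
    case (Cons a l')
    then show ?thesis
      by (cases "a = Suc k") (auto simp: lists_hd_above_def)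
  qed (simp add: lists_hd_above_def)
qed

lemma list_gf_lists_hd_above_split:
  "list_gf (lists_hd_above R k) = list_gf (lists_hd_above R (Suc k))
     + fps_X * (q_power (Suc k) * list_gf {l. successively R (Suc k # l)})"
proof -
  have "lists_hd_above R (Suc k) \<inter> (#) (Suc k) ` {l. successively R (Suc k # l)} = {}"
    by (auto simp: lists_hd_above_def)
  then show ?thesis
    by (subst lists_hd_above_split) (simp only: list_gf_Un list_gf_Cons)
qed

lemma successively_Cons_eq_lists_hd_above:
  assumes "\<And>b. R a b \<longleftrightarrow> c < b"
  shows "{l. successively R (a # l)} = lists_hd_above R c"
  by (auto simp: lists_hd_above_def successively_Cons assms)

lemma list_gf_lists_hd_above_nth_low:
  assumes "n \<le> k"
  shows "list_gf (lists_hd_above R k) $ m $ n = 1 $ m $ n"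
proof -
  have "l \<in> lists_hd_above R k \<and> length l = m \<and> sum_list l = n \<longleftrightarrow> l = [] \<and> m = 0 \<and> n = 0" for l
    using assms by (cases l) (auto simp: lists_hd_above_def)
  then have "{l \<in> lists_hd_above R k. length l = m \<and> sum_list l = n}
      = (if m = 0 \<and> n = 0 then {[]} else {})"
    by auto
  then show ?thesis
    by (simp add: list_gf_def del: Collect_empty_eq)
qed

subsection \<open>Partitions with admissible gaps\<close>

definition gap :: "nat \<Rightarrow> nat \<Rightarrow> bool" where
  "gap a b \<longleftrightarrow> a + 2 \<le> b \<and> ((a + b) mod 3 = 2 \<or> a + 4 \<le> b)"

lemma gap_iff_diff:
  "gap a b \<longleftrightarrow> a \<le> b \<and> b - a \<ge> 2 \<and> (\<not> [a + b = 2] (mod 3) \<longrightarrow> b - a \<ge> 4)"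
  by (auto simp: gap_def cong_def)

lemma successively_gap_iff: "successively gap l \<longleftrightarrow> sorted l \<and> cp12_condition l"
  unfolding successively_conv_nth sorted_iff_nth_Suc cp12_condition_def gap_iff_diff by blast

lemma cp12_eq_card_lists_hd_above:
  "cp12 n m = card {l \<in> lists_hd_above gap 0. length l = m \<and> sum_list l = n}"
proof -
  have "(\<forall>a\<in>set l. 0 < a) \<longleftrightarrow> l = [] \<or> 0 < hd l" if "sorted l" for l :: "nat list"
    using that by (cases l) auto
  then have "partition_into n m l \<and> cp12_condition l
      \<longleftrightarrow> l \<in> lists_hd_above gap 0 \<and> length l = m \<and> sum_list l = n" for l
    by (auto simp: partition_into_def lists_hd_above_def successively_gap_iff)
  then show ?thesis
    by (simp add: cp12_def)
qed

definition gap_bound :: "nat \<Rightarrow> nat" where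
  "gap_bound k = (if k mod 3 = 0 then k + 3 else k + 4)"

lemma gap_iff_mod_3:
  "gap a b \<longleftrightarrow> a + 4 \<le> b \<or> b = a + 2 \<and> a mod 3 = 0 \<or> b = a + 3 \<and> a mod 3 = 1"
proof -
  have mod_shift:
    "(a + (a + 2)) mod 3 = 2 \<longleftrightarrow> a mod 3 = 0"
    "(a + (a + 3)) mod 3 = 2 \<longleftrightarrow> a mod 3 = 1"
    by presburger+
  consider "b < a + 2" | "b = a + 2" | "b = a + 3" | "a + 4 \<le> b"
    by linarith
  then show ?thesis
    by cases (use mod_shift in \<open>auto simp: gap_def\<close>)
qed

lemma gap_Suc_iff: "gap (Suc k) b \<longleftrightarrow> gap_bound k < b \<or> k mod 3 = 2 \<and> b = k + 3"
  by (auto simp: gap_iff_mod_3 gap_bound_def mod_Suc)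

definition smallest_part_recurrence :: "(nat \<Rightarrow> 'a::comm_semiring_1 fps fps) \<Rightarrow> bool" where
  "smallest_part_recurrence F \<longleftrightarrow> (\<forall>k. F k = F (Suc k)
     + fps_X * (q_power (k + 1) * F (gap_bound k)
       + (if k mod 3 = 2 then fps_X * q_power (2 * k + 4) else 0) * F (k + 6)))"

lemma list_gf_successively_gap_Cons:
  "list_gf {l. successively gap (Suc k # l)} = list_gf (lists_hd_above gap (gap_bound k))
     + (if k mod 3 = 2
        then fps_X * (q_power (k + 3) * list_gf (lists_hd_above gap (k + 6))) else 0)"
proof (cases "k mod 3 = 2")
  case True
  then have "gap (k + 3) b \<longleftrightarrow> k + 6 < b" for b
    by (auto simp: gap_iff_mod_3)
  then have tails: "{l. successively gap ((k + 3) # l)} = lists_hd_above gap (k + 6)"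
    by (rule successively_Cons_eq_lists_hd_above)
  have "{l. successively gap (Suc k # l)}
      = lists_hd_above gap (gap_bound k) \<union> (#) (k + 3) ` {l. successively gap ((k + 3) # l)}"
  proof (rule set_eqI)
    fix l
    show "l \<in> {l. successively gap (Suc k # l)} \<longleftrightarrow>
        l \<in> lists_hd_above gap (gap_bound k) \<union> (#) (k + 3) ` {l. successively gap ((k + 3) # l)}"
      using True by (cases l) (auto simp: lists_hd_above_def gap_Suc_iff)
  qed
  moreover have "lists_hd_above gap (gap_bound k) \<inter> (#) (k + 3) ` lists_hd_above gap (k + 6) = {}"
    by (auto simp: lists_hd_above_def gap_bound_def)
  ultimately show ?thesis
    using True by (simp only: tails list_gf_Un list_gf_Cons simp_thms if_True)
next
  case False
  then have "{l. successively gap (Suc k # l)} = lists_hd_above gap (gap_bound k)"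
    by (intro successively_Cons_eq_lists_hd_above) (simp add: gap_Suc_iff)
  with False show ?thesis
    by simp
qed

lemma smallest_part_recurrence_list_gf:
  "smallest_part_recurrence (\<lambda>k. list_gf (lists_hd_above gap k) :: 'a::comm_semiring_1 fps fps)"
  unfolding smallest_part_recurrence_def
proof
  fix k
  let ?G = "\<lambda>k. list_gf (lists_hd_above gap k) :: 'a fps fps"
  have q_split: "q_power (2 * k + 4) = (q_power (k + 1) * q_power (k + 3) :: 'a fps fps)"
    by (rule q_power_eq_mult) simp
  have "?G k = ?G (Suc k) + fps_X * (q_power (k + 1) * (?G (gap_bound k)
      + (if k mod 3 = 2 then fps_X * (q_power (k + 3) * ?G (k + 6)) else 0)))"
    using list_gf_lists_hd_above_split[of gap k]
    by (simp only: list_gf_successively_gap_Cons flip: Suc_eq_plus1)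
  also have "\<dots> = ?G (Suc k) + fps_X * (q_power (k + 1) * ?G (gap_bound k)
      + (if k mod 3 = 2 then fps_X * q_power (2 * k + 4) else 0) * ?G (k + 6))"
    unfolding q_split
    by (cases "k mod 3 = 2") (simp_all only: distrib_left mult_ac simp_thms if_True if_False
        mult_zero_left mult_zero_right)
  finally show "?G k = \<dots>" .
qed

subsection \<open>Solving the recurrence\<close>

definition nearest_multiple :: "nat \<Rightarrow> nat" where
  "nearest_multiple k = 3 * ((2 * k + 1) div 3)"

lemma nearest_multiple_mod_3_eq_0:
  assumes "k mod 3 = 0"
  shows "nearest_multiple k = 2 * k"
    and "nearest_multiple (k + 1) = 2 * k + 3"
    and "nearest_multiple (k + 3) = 2 * k + 6"
  unfolding nearest_multiple_def using assms by presburger+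

lemma nearest_multiple_mod_3_eq_1:
  assumes "k mod 3 = 1"
  shows "nearest_multiple k = 2 * k + 1"
    and "nearest_multiple (k + 1) = 2 * k + 1"
    and "nearest_multiple (k + 4) = 2 * k + 7"
  unfolding nearest_multiple_def using assms by presburger+

lemma nearest_multiple_mod_3_eq_2:
  assumes "k mod 3 = 2"
  shows "nearest_multiple k + 5 = 2 * k + 4"
    and "nearest_multiple (k + 1) = 2 * k + 2"
    and "nearest_multiple (k + 4) = 2 * k + 8"
    and "nearest_multiple (k + 6) = 2 * k + 11"
  unfolding nearest_multiple_def using assms by presburger+

definition shifted_series :: "nat \<Rightarrow> 'a::field fps fps" where
  "shifted_series k = double_series k (nearest_multiple k)"

lemma smallest_part_recurrence_shifted_series:
  "smallest_part_recurrence (shifted_series :: nat \<Rightarrow> 'a::field fps fps)"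
  unfolding smallest_part_recurrence_def
proof
  fix k :: nat
  let ?T = "shifted_series :: nat \<Rightarrow> 'a fps fps"
  let ?j = "nearest_multiple k"
  consider "k mod 3 = 0" | "k mod 3 = 1" | "k mod 3 = 2"
    by linarith
  then show "?T k = ?T (Suc k) + fps_X * (q_power (k + 1) * ?T (gap_bound k)
      + (if k mod 3 = 2 then fps_X * q_power (2 * k + 4) else 0) * ?T (k + 6))"
  proof cases
    case 1
    then show ?thesis
      using nearest_multiple_mod_3_eq_0[OF 1] double_series_shift_diagonal[of k]
      by (simp add: shifted_series_def gap_bound_def)
  next
    case 2
    have "nearest_multiple (k + 1) = ?j" "nearest_multiple (k + 4) = ?j + 6"
      using nearest_multiple_mod_3_eq_1[OF 2] by simp_all
    then show ?thesis
      using 2 double_series_shift_left[of k ?j] by (simp add: shifted_series_def gap_bound_def)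
  next
    case 3
    have "?j + 3 = nearest_multiple (k + 1)" "?j + 9 = nearest_multiple (k + 4)"
        "?j + 12 = nearest_multiple (k + 6)"
      using nearest_multiple_mod_3_eq_2[OF 3] by simp_all
    then have "?T k = ?T (k + 1) + fps_X * (q_power (k + 1) * ?T (k + 4))
        + fps_X\<^sup>2 * (q_power (2 * k + 4) * ?T (k + 6))"
      using double_series_shift_both[of k ?j]
      by (simp only: shifted_series_def nearest_multiple_mod_3_eq_2[OF 3])
    with 3 show ?thesis
      by (simp add: gap_bound_def distrib_left mult.assoc add.assoc power2_eq_square)
  qed
qed

lemma fps_recurrence_unique:
  fixes F G :: "nat \<Rightarrow> 'a::comm_semiring_1 fps fps"
  assumes F_rec: "\<And>k. F k = F (Suc k) + fps_X * (a k * F (s k) + b k * F (t k))"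
    and G_rec: "\<And>k. G k = G (Suc k) + fps_X * (a k * G (s k) + b k * G (t k))"
    and limit: "\<And>m n. \<forall>\<^sub>F k in sequentially. F k $ m $ n = G k $ m $ n"
  shows "F = G"
proof -
  have "\<forall>k. F k $ m = G k $ m" for m
  proof (induction m rule: less_induct)
    case (less m)
    have lower_terms: "(fps_X * (a k * F (s k) + b k * F (t k))) $ m
        = (fps_X * (a k * G (s k) + b k * G (t k))) $ m" for k
      using less by (auto simp: fps_mult_nth intro!: sum.cong arg_cong2[of _ _ _ _ "(+)"])
    have "F k $ m $ n = G k $ m $ n" for k n
    proof -
      obtain N where N: "\<And>l. l \<ge> N \<Longrightarrow> F l $ m $ n = G l $ m $ n"
        using limit[of m n] by (auto simp: eventually_sequentially)
      have "k \<le> max k N"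
        by simp
      then show ?thesis
      proof (induction rule: inc_induct)
        case base
        show ?case
          by (rule N) simp
      next
        case (step l)
        then show ?case
          by (subst F_rec, subst G_rec) (simp only: fps_add_nth lower_terms)
      qed
    qed
    then show ?case
      by (simp add: fps_eq_iff)
  qed
  then show ?thesis
    by (simp add: fun_eq_iff fps_eq_iff)
qed

lemma list_gf_lists_hd_above_gap: "list_gf (lists_hd_above gap k) = shifted_series k"
proof -
  have "(\<lambda>k. list_gf (lists_hd_above gap k)) = (shifted_series :: nat \<Rightarrow> 'a fps fps)"
  proof (rule fps_recurrence_unique)
    fix m n :: nat
    have "list_gf (lists_hd_above gap k) $ m $ n = (shifted_series k $ m $ n :: 'a)"
      if "n \<le> k" for k
    proof -
      have "n < nearest_multiple k + 5"
        using that unfolding nearest_multiple_def by linarith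
      with that show ?thesis
        by (simp add: list_gf_lists_hd_above_nth_low shifted_series_def double_series_nth_low)
    qed
    then show "\<forall>\<^sub>F k in sequentially.
        list_gf (lists_hd_above gap k) $ m $ n = (shifted_series k $ m $ n :: 'a)"
      using eventually_ge_at_top by (rule eventually_mono[rotated])
  qed (use smallest_part_recurrence_list_gf smallest_part_recurrence_shifted_series in
      \<open>unfold smallest_part_recurrence_def, blast+\<close>)
  then show ?thesis
    by (rule fun_cong)
qed

theorem theorem12:
  shows "((\<lambda>(n1 :: nat, n2 :: nat).
             fps_const (q_var ^ (6 * n2\<^sup>2 - n2 + 2 * n1\<^sup>2 - n1 + 6 * n2 * n1) /
                        (qpochhammer q_var q_var n1 * qpochhammer (q_var ^ 3) (q_var ^ 3) n2)) *
             x_var ^ (2 * n2 + n1))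
           has_sum Abs_fps (\<lambda>m. Abs_fps (\<lambda>n. of_nat (cp12 n m)))) UNIV"
    (is "(?f has_sum ?g) UNIV")
proof -
  have "?f = (\<lambda>p. fps_const (case p of (a, b) \<Rightarrow> qterm 0 0 a b) * x_var ^ pair_weight p)"
    by (auto simp: fun_eq_iff qterm_def qexp_def pair_weight_def fps_divide_unit
        qpochhammer_fps_nth_0 fps_inverse_mult mult.assoc add.commute)
  moreover have "?g = double_series 0 0"
    using list_gf_lists_hd_above_gap[of 0]
    by (simp add: list_gf_def cp12_eq_card_lists_hd_above shifted_series_def
        nearest_multiple_def)
  ultimately show ?thesis
    unfolding double_series_def by (simp only: has_sum_weighted_gf finite_pair_weight)
qed

end
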